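(* Let $k > d$ be non-negative integers. If $G$ is a $k$-degenerate graph on $n$ vertices, then $$\alpha_d(G) \geq \max\Big\{ \frac{(d+1)n}{k+d+1},\; n - \alpha_{k-d-1}(G)\Big\}.$$ Furthermore, $V(G)$ can be partitioned into sets $X$ and $Y$ such that the induced subgraph $G[X]$ is $d$-degenerate and the induced subgraph $G[Y]$ is $(k-d-1)$-degenerate.
   Context: Graphs are finite and simple, and $n = |V(G)|$. For a non-negative integer $d$, a graph $G$ is $d$-degenerate if every (nonempty) subgraph $H$ of $G$ has minimum degree at most $d$. For a graph $G$ and a non-negative integer $d$, $\alpha_d(G)$ denotes the order (number of vertices) of a largest induced $d$-degenerate subgraph of $G$. Parts of a partition are allowed to be empty. *)

theory Defs
  imports Complex_Main "Graph_Theory.Digraph_Component"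
begin

text \<open>
  Finite simple graphs are the symmetric loop-free digraphs without parallel arcs of the locale
  \<^locale>\<open>graph\<close>: an undirected edge is a pair of opposite arcs, so the degree of a vertex
  is its out-degree.
\<close>

definition min_degree :: "('a, 'b) pre_digraph \<Rightarrow> nat" where
  "min_degree H = Min (out_degree H ` verts H)"

text \<open>
  \<^const>\<open>subgraph\<close> also admits subdigraphs containing only one of two opposite arcs; the
  condition that \<open>H\<close> is a \<^const>\<open>graph\<close> leaves exactly the undirected subgraphs.
\<close>

definition degenerate :: "nat \<Rightarrow> ('a, 'b) pre_digraph \<Rightarrow> bool" where
  "degenerate d G \<longleftrightarrow>
     (\<forall>H. subgraph H G \<and> graph H \<and> verts H \<noteq> {} \<longrightarrow> min_degree H \<le> d)"

text \<open>
  For a finite graph \<open>G\<close> the maximum is over a finite set, and the set is nonempty because the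
  null graph is an induced subgraph of \<open>G\<close> and is \<open>d\<close>-degenerate.
\<close>

definition alpha :: "nat \<Rightarrow> ('a, 'b) pre_digraph \<Rightarrow> nat" where
  "alpha d G = Max {card (verts H) | H. induced_subgraph H G \<and> degenerate d H}"

end

theory Submission
  imports Defs
begin

text \<open>
  Remove a vertex of degree at most \<open>k\<close>, partition the rest, and put the vertex back into a part
  containing few of its neighbours. If the degree bounds \<open>d\<^sub>i\<close> of the parts satisfy
  \<open>k + 1 \<le> (\<Sum>i. d\<^sub>i + 1)\<close>, then some part \<open>i\<close> contains at most \<open>d\<^sub>i\<close> neighbours, and stays
  \<open>d\<^sub>i\<close>-degenerate. The bounds \<open>d\<close> and \<open>k - d - 1\<close> give the
  bipartition, and \<open>\<lfloor>k / (d + 1)\<rfloor> + 1\<close> parts that all have bound \<open>d\<close> give the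
  linear lower bound by averaging.
\<close>

context graph
begin

text \<open>Lets the results on \<open>G \<restriction> S\<close> be applied to \<open>G\<close>
  itself by taking \<open>S = verts G\<close>.\<close>

lemma induce_verts_self [simp]: "G \<restriction> verts G = G"
  by (rule pre_digraph.equality) auto

lemma graph_induce_subgraph:
  assumes "S \<subseteq> verts G"
  shows "graph (G \<restriction> S)"
  using induced_graph_imp_graph induced_induce[OF assms] digraphI_induced
    graph_def digraph.graphI induced_graph_imp_symmetric sym_arcs by blast

text \<open>Among the subgraphs with a given vertex set, the induced one has the largest degrees, so
  it suffices to test induced subgraphs. Degeneracy thus becomes a condition on vertex sets of the
  one fixed graph \<open>G\<close>.\<close>

lemma degenerate_induce_subgraph_iff:
  assumes S: "S \<subseteq> verts G"
  shows "degenerate d (G \<restriction> S) \<longleftrightarrow>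
           (\<forall>T \<subseteq> S. T \<noteq> {} \<longrightarrow> (\<exists>v\<in>T. out_degree (G \<restriction> T) v \<le> d))"
    (is "_ \<longleftrightarrow> ?local")
proof
  assume deg: "degenerate d (G \<restriction> S)"
  show ?local
  proof (intro allI impI)
    fix T assume T: "T \<subseteq> S" "T \<noteq> {}"
    have "finite T"
      using T(1) S finite_verts by (meson finite_subset)
    have "subgraph (G \<restriction> T) (G \<restriction> S)"
      using T(1) S by (auto simp: subgraph_def compatible_def)
    with T S have "min_degree (G \<restriction> T) \<le> d"
      using deg graph_induce_subgraph[of T] by (auto simp: degenerate_def)
    then show "\<exists>v\<in>T. out_degree (G \<restriction> T) v \<le> d"
      using T(2) \<open>finite T\<close> by (simp add: min_degree_def Min_le_iff)
  qed
next
  assume loc: ?local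
  show "degenerate d (G \<restriction> S)"
    unfolding degenerate_def
  proof (intro allI impI, elim conjE)
    fix H assume sub: "subgraph H (G \<restriction> S)" and "graph H" and ne: "verts H \<noteq> {}"
    interpret H: graph H by fact
    have "verts H \<subseteq> S"
      using sub by (simp add: subgraph_def)
    then obtain v where v: "v \<in> verts H" "out_degree (G \<restriction> verts H) v \<le> d"
      using loc ne by blast
    have "out_arcs H v \<subseteq> out_arcs (G \<restriction> verts H) v"
    proof
      fix e assume e: "e \<in> out_arcs H v"
      have "arcs H \<subseteq> arcs (G \<restriction> S)" "tail H = tail G" "head H = head G"
        using sub by (auto simp: subgraph_def compatible_def)
      with e show "e \<in> out_arcs (G \<restriction> verts H) v"
        using H.tail_in_verts[of e] H.head_in_verts[of e] by auto
    qed
    then have "out_degree H v \<le> out_degree (G \<restriction> verts H) v"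
      unfolding out_degree_def by (intro card_mono) (auto simp: out_arcs_def)
    with v ne show "min_degree H \<le> d"
      unfolding min_degree_def by (auto simp: Min_le_iff intro!: bexI[of _ v])
  qed
qed

lemma degenerate_induce_subset:
  assumes "S \<subseteq> verts G" "T \<subseteq> S" "degenerate d (G \<restriction> S)"
  shows "degenerate d (G \<restriction> T)"
proof -
  have "T \<subseteq> verts G"
    using assms by blast
  with assms show ?thesis
    by (meson degenerate_induce_subgraph_iff order_trans)
qed

text \<open>A set \<open>T\<close> containing \<open>v\<close> has \<open>v\<close> as its vertex of
  small degree, since degrees can only drop on passing to a smaller induced subgraph; any other
  \<open>T\<close> already lies in \<open>S\<close>.\<close>

lemma degenerate_induce_insert:
  assumes S: "S \<subseteq> verts G" and v: "v \<in> verts G"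
    and deg: "degenerate d (G \<restriction> S)"
    and v_deg: "out_degree (G \<restriction> insert v S) v \<le> d"
  shows "degenerate d (G \<restriction> insert v S)"
proof -
  have "\<exists>u\<in>T. out_degree (G \<restriction> T) u \<le> d" if T: "T \<subseteq> insert v S" "T \<noteq> {}" for T
  proof (cases "v \<in> T")
    case True
    have "out_degree (G \<restriction> T) v \<le> out_degree (G \<restriction> insert v S) v"
      unfolding out_degree_def using T(1) by (intro card_mono) (auto simp: out_arcs_def)
    with True v_deg show ?thesis
      by (meson order_trans)
  next
    case False
    with T have "T \<subseteq> S"
      by blast
    with T deg S show ?thesis
      by (simp add: degenerate_induce_subgraph_iff)
  qed
  with S v show ?thesis
    by (simp add: degenerate_induce_subgraph_iff)
qed

text \<open>The parts are the colour classes of \<open>f\<close>. A separate bound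
  \<open>d i\<close> for each colour lets one induction serve both the bipartition and the linear
  bound.\<close>

lemma degenerate_induce_colouring:
  assumes I: "finite I" and k: "k < (\<Sum>i\<in>I. d i + 1)"
    and "S \<subseteq> verts G" "degenerate k (G \<restriction> S)"
  shows "\<exists>f. f ` S \<subseteq> I \<and> (\<forall>i\<in>I. degenerate (d i) (G \<restriction> {v \<in> S. f v = i}))"
proof -
  have "finite S"
    using assms(3) finite_verts by (rule finite_subset)
  then show ?thesis
    using assms(3,4)
  proof (induction S rule: finite_psubset_induct)
    case (psubset S)
    show ?case
    proof (cases "S = {}")
      case True
      then show ?thesis
        by (simp add: degenerate_induce_subgraph_iff)
    next
      case False
      then obtain v where v: "v \<in> S" and v_deg: "out_degree (G \<restriction> S) v \<le> k"
        using psubset.prems by (meson degenerate_induce_subgraph_iff subset_refl)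
      let ?S = "S - {v}"
      have "degenerate k (G \<restriction> ?S)"
        using psubset.prems by (rule_tac degenerate_induce_subset) auto
      with v psubset.prems obtain f where f: "f ` ?S \<subseteq> I"
        and f_deg: "\<And>i. i \<in> I \<Longrightarrow> degenerate (d i) (G \<restriction> {u \<in> ?S. f u = i})"
        using psubset.IH[of ?S] by blast
      \<comment> \<open>\<open>A i\<close> consists of the arcs from \<open>v\<close> into colour
        class \<open>i\<close>; its size is the degree that \<open>v\<close> would have after
        joining that class.\<close>
      define A where "A i = out_arcs (G \<restriction> insert v {u \<in> ?S. f u = i}) v" for i
      have fin_A: "finite (A i)" for i
        by (rule finite_subset[OF _ finite_arcs]) (auto simp: A_def)
      have "\<exists>i\<in>I. card (A i) \<le> d i"
      proof (rule ccontr)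
        assume "\<not> ?thesis"
        then have "(\<Sum>i\<in>I. d i + 1) \<le> (\<Sum>i\<in>I. card (A i))"
          by (intro sum_mono) (simp add: not_le Suc_le_eq)
        \<comment> \<open>The sets \<open>A i\<close> are disjoint: the head of an arc from
          \<open>v\<close> is not \<open>v\<close>, as there are no loops, so it has exactly one
          colour.\<close>
        also have "\<dots> = card (\<Union>i\<in>I. A i)"
          using I fin_A by (subst card_UN_disjoint) (auto simp: A_def dest: no_loops[symmetric])
        also have "\<dots> \<le> out_degree (G \<restriction> S) v"
          unfolding out_degree_def
          using v by (intro card_mono finite_subset[OF _ finite_arcs]) (auto simp: A_def out_arcs_def)
        finally show False
          using k v_deg by simp
      qed
      then obtain i where i: "i \<in> I" "card (A i) \<le> d i"
        by blast
      let ?f = "f(v := i)"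
      have "degenerate (d j) (G \<restriction> {u \<in> S. ?f u = j})" if j: "j \<in> I" for j
      proof (cases "j = i")
        case True
        have "{u \<in> S. ?f u = j} = insert v {u \<in> ?S. f u = i}"
          using v True by auto
        moreover have "degenerate (d i) (G \<restriction> insert v {u \<in> ?S. f u = i})"
          using i v psubset.prems f_deg
          by (intro degenerate_induce_insert) (auto simp: A_def out_degree_def)
        ultimately show ?thesis
          using True by simp
      next
        case False
        then have "{u \<in> S. ?f u = j} = {u \<in> ?S. f u = j}"
          by auto
        with f_deg[OF j] show ?thesis
          by simp
      qed
      moreover have "?f ` S \<subseteq> I"
        using f i by auto
      ultimately show ?thesis
        by blast
    qed
  qed
qed

text \<open>\<open>alpha\<close> is a \<open>Max\<close>, which bounds its elements only for a
  finite set; here all orders are at most \<open>card (verts G)\<close>.\<close>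

lemma card_le_alpha:
  assumes "S \<subseteq> verts G" "degenerate d (G \<restriction> S)"
  shows "card S \<le> alpha d G"
proof -
  have "finite {card (verts H) | H. induced_subgraph H G \<and> degenerate d H}"
    by (rule finite_subset[of _ "{..card (verts G)}"])
      (auto simp: induced_subgraph_def subgraph_def intro: card_mono)
  then show ?thesis
    unfolding alpha_def using assms induced_induce[OF assms(1)]
    by (intro Max_ge) (auto intro!: exI[of _ "G \<restriction> S"])
qed

lemma degenerate_partition:
  assumes "d < k" "degenerate k G"
  obtains X Y where "X \<union> Y = verts G" "X \<inter> Y = {}"
    "degenerate d (G \<restriction> X)" "degenerate (k - d - 1) (G \<restriction> Y)"
proof -
  \<comment> \<open>The two truth values serve as colours. Since \<open>d < k\<close>, the
    subtraction does not truncate, and \<open>(d + 1) + (k - d - 1 + 1) = k + 1\<close> is just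
    enough.\<close>
  define b where "b = (\<lambda>x. if x then d else k - d - 1)"
  have "k < (\<Sum>x\<in>UNIV. b x + 1)"
    using assms(1) by (simp add: UNIV_bool b_def)
  then obtain f where f: "\<And>x. degenerate (b x) (G \<restriction> {v \<in> verts G. f v = x})"
    using degenerate_induce_colouring[of UNIV k b "verts G"] assms(2) by auto
  show ?thesis
  proof
    show "degenerate d (G \<restriction> {v \<in> verts G. f v = True})"
      using f[of True] by (simp add: b_def)
    show "degenerate (k - d - 1) (G \<restriction> {v \<in> verts G. f v = False})"
      using f[of False] by (simp add: b_def)
  qed auto
qed

lemma alpha_linear_bound:
  assumes "degenerate k G"
  shows "(d + 1) * card (verts G) \<le> (k + d + 1) * alpha d G"
proof -
  \<comment> \<open>\<open>q + 1\<close> is the least number of colours with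
    \<open>k < (d + 1) * (q + 1)\<close>.\<close>
  define q where "q = k div (d + 1)"
  have "k < (d + 1) * (q + 1)"
    unfolding q_def using dividend_less_times_div[of "d + 1" k] by simp
  then have "k < (\<Sum>i\<in>{..q}. d + 1)"
    by (simp add: algebra_simps)
  then obtain f where f: "f ` verts G \<subseteq> {..q}"
    and f_deg: "\<And>i. i \<le> q \<Longrightarrow> degenerate d (G \<restriction> {v \<in> verts G. f v = i})"
    using degenerate_induce_colouring[of "{..q}" k "\<lambda>_. d" "verts G"] assms by auto
  have "verts G = (\<Union>i\<le>q. {v \<in> verts G. f v = i})"
    using f by auto
  then have "card (verts G) \<le> (\<Sum>i\<le>q. card {v \<in> verts G. f v = i})"
    by (metis card_UN_le finite_atMost)
  also have "\<dots> \<le> (\<Sum>i\<le>q. alpha d G)"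
    using f_deg by (intro sum_mono card_le_alpha) auto
  finally have "(d + 1) * card (verts G) \<le> (d + 1) * ((q + 1) * alpha d G)"
    by (intro mult_le_mono2) simp
  \<comment> \<open>Splitting off the last colour leaves \<open>(d + 1) * q\<close>, which is at
    most \<open>k\<close> because \<open>q\<close> is a rounded-down quotient.\<close>
  also have "\<dots> = ((d + 1) * q + d + 1) * alpha d G"
    by (simp add: algebra_simps)
  also have "\<dots> \<le> (k + d + 1) * alpha d G"
    unfolding q_def by (intro mult_le_mono1 add_le_mono1 times_div_less_eq_dividend)
  finally show ?thesis .
qed

end

theorem theorem1p1:
  fixes G :: "('a, 'b) pre_digraph" and k d n :: nat
  assumes "d < k"
    and "graph G"
    and "card (verts G) = n"
    and "degenerate k G"
  shows "real (alpha d G) \<ge>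
           max ((real d + 1) * real n / (real k + real d + 1))
               (real n - real (alpha (k - d - 1) G)) \<and>
         (\<exists>X Y. X \<union> Y = verts G \<and> X \<inter> Y = {} \<and>
            degenerate d (G \<restriction> X) \<and> degenerate (k - d - 1) (G \<restriction> Y))"
proof -
  interpret graph G by fact
  obtain X Y where XY: "X \<union> Y = verts G" "X \<inter> Y = {}"
    "degenerate d (G \<restriction> X)" "degenerate (k - d - 1) (G \<restriction> Y)"
    using degenerate_partition[OF assms(1,4)] .
  have "finite X" "finite Y"
    using XY(1) finite_verts by (metis finite_Un)+
  \<comment> \<open>The second term of the maximum follows from the bipartition: each part is a
    candidate for the corresponding \<open>alpha\<close>.\<close>
  with XY(1,2) have "n = card X + card Y"
    using assms(3) card_Un_disjoint by metis
  also have "\<dots> \<le> alpha d G + alpha (k - d - 1) G"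
    using XY by (intro add_mono card_le_alpha) auto
  finally have "real n - real (alpha (k - d - 1) G) \<le> real (alpha d G)"
    by linarith
  moreover have "real ((d + 1) * n) \<le> real ((k + d + 1) * alpha d G)"
    using alpha_linear_bound[OF assms(4), of d] assms(3) of_nat_mono by blast
  then have "(real d + 1) * real n / (real k + real d + 1) \<le> real (alpha d G)"
    by (simp add: field_simps)
  ultimately show ?thesis
    using XY by auto
qed

end
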